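(* Let $d$ and $n$ be positive integers with $n \geq d+1$, and let $\tau_1 < \tau_2 < \cdots < \tau_n$ be integers. If $\tau_{i+1} - \tau_i \geq d^2 - 1$ for all $1 \leq i \leq n-1$, then the cyclic polytope $C_d(\tau_1, \ldots, \tau_n)$ is normal. In particular, $\gamma_d \leq d^2 - 1$.
   Context: For real numbers $\tau_1 < \cdots < \tau_n$ with $n \geq d+1$, the cyclic polytope $C_d(\tau_1,\ldots,\tau_n) \subset \mathbb{R}^d$ is the convex hull of the points $(\tau_i, \tau_i^2, \ldots, \tau_i^d)$, $1 \leq i \leq n$. For an integral convex polytope $\mathcal{P} \subset \mathbb{R}^N$ (all vertices in $\mathbb{Z}^N$), let $\mathcal{P}^* \subset \mathbb{R}^{N+1}$ be the convex hull of all points $(1,\alpha)$ with $\alpha \in \mathcal{P}$, and let $\mathcal{A}_{\mathcal{P}} = \mathcal{P}^* \cap \mathbb{Z}^{N+1}$. The polytope $\mathcal{P}$ is called normal if $\mathbb{Z}_{\geq 0}\mathcal{A}_{\mathcal{P}} = \mathbb{Z}\mathcal{A}_{\mathcal{P}} \cap \mathbb{Q}_{\geq 0}\mathcal{A}_{\mathcal{P}}$. For a positive integer $d$, $\gamma_d$ denotes the smallest integer such that for every $n \geq d+1$ and all integers $\tau_1 < \cdots < \tau_n$ with $\tau_{i+1} - \tau_i \geq \gamma_d$ for $1 \leq i < n$, the polytope $C_d(\tau_1,\ldots,\tau_n)$ is normal. *)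

theory Defs
  imports "HOL-Analysis.Analysis" "HOL-Library.Function_Algebras"
begin

text \<open>
  The dimension \<open>d\<close> is a natural number (it is an exponent range and an argument of \<open>gamma\<close>), so
  \<open>\<real>\<^sup>N\<close> is realised as the subspace of \<open>nat \<Rightarrow> real\<close> of all \<open>v\<close> with \<open>v k = 0\<close> for \<open>k \<ge> N\<close>.
  The pointwise vector space structure makes the library's \<open>convex hull\<close> available; convex hulls of
  subsets of \<open>\<real>\<^sup>N\<close> stay inside \<open>\<real>\<^sup>N\<close>.
\<close>

instantiation "fun" :: (type, real_vector) real_vector
begin

definition scaleR_fun :: "real \<Rightarrow> ('a \<Rightarrow> 'b) \<Rightarrow> 'a \<Rightarrow> 'b" where
  "scaleR_fun c f = (\<lambda>x. c *\<^sub>R f x)"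

instance
  by standard (simp_all add: scaleR_fun_def fun_eq_iff scaleR_add_right scaleR_add_left)

end

text \<open>Coordinates are numbered from 0: the point is \<open>(t, t\<^sup>2, \<dots>, t\<^sup>d)\<close>.\<close>

definition moment_point :: "nat \<Rightarrow> real \<Rightarrow> nat \<Rightarrow> real" where
  "moment_point d t = (\<lambda>k. if k < d then t ^ (k + 1) else 0)"

definition cyclic_polytope :: "nat \<Rightarrow> nat \<Rightarrow> (nat \<Rightarrow> real) \<Rightarrow> (nat \<Rightarrow> real) set" where
  "cyclic_polytope d n \<tau> = convex hull ((\<lambda>i. moment_point d (\<tau> i)) ` {1..n})"

text \<open>The point \<open>(1, \<alpha>)\<close>; it lies in \<open>\<real>\<^bsup>N+1\<^esup>\<close> whenever \<open>\<alpha>\<close> lies in \<open>\<real>\<^sup>N\<close>.\<close>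

definition homogenize :: "(nat \<Rightarrow> real) \<Rightarrow> nat \<Rightarrow> real" where
  "homogenize \<alpha> = (\<lambda>k. case k of 0 \<Rightarrow> 1 | Suc j \<Rightarrow> \<alpha> j)"

text \<open>Intersecting a subset of \<open>\<real>\<^sup>N\<close> with this set is the same as intersecting it with \<open>\<int>\<^sup>N\<close>.\<close>

definition integer_points :: "(nat \<Rightarrow> real) set" where
  "integer_points = {v. \<forall>k. v k \<in> \<int>}"

definition lattice_config :: "(nat \<Rightarrow> real) set \<Rightarrow> (nat \<Rightarrow> real) set" where
  "lattice_config P = (convex hull (homogenize ` P)) \<inter> integer_points"

text \<open>
  \<open>combinations K A\<close> is the set \<open>K A\<close> of all finite linear combinations of elements of \<open>A\<close> with
  coefficients in \<open>K\<close>.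
\<close>

definition combinations :: "real set \<Rightarrow> 'a::real_vector set \<Rightarrow> 'a set" where
  "combinations K A =
     {\<Sum>a\<in>F. c a *\<^sub>R a | F c. finite F \<and> F \<subseteq> A \<and> (\<forall>a\<in>F. c a \<in> K)}"

text \<open>Normality is only meant for integral convex polytopes \<open>P\<close>.\<close>

definition normal_polytope :: "(nat \<Rightarrow> real) set \<Rightarrow> bool" where
  "normal_polytope P \<longleftrightarrow>
     combinations \<nat> (lattice_config P) =
     combinations \<int> (lattice_config P) \<inter> combinations {q \<in> \<rat>. 0 \<le> q} (lattice_config P)"

text \<open>
  \<open>gamma\<close> is a least natural number: since the \<open>\<tau> i\<close> are strictly increasing integers, a gap
  condition with bound at most 1 is vacuous, so over all integers either the least valid bound is positive,
  and then it is the value below, or there is none because every integer is a valid bound.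
\<close>

definition gamma :: "nat \<Rightarrow> nat" where
  "gamma d = (LEAST g. \<forall>n \<tau>. d + 1 \<le> n \<longrightarrow> strict_mono_on {1..n} \<tau> \<longrightarrow>
     (\<forall>i. 1 \<le> i \<and> i < n \<longrightarrow> \<tau> (i + 1) - \<tau> i \<ge> int g) \<longrightarrow>
     normal_polytope (cyclic_polytope d n (\<lambda>i. real_of_int (\<tau> i))))"

end

theory Submission
  imports Defs
begin

text \<open>
  A lattice point \<open>\<alpha>\<close> of height \<open>k \<ge> 2\<close> in the cone over the polytope is split as \<open>\<alpha> = \<beta> + (\<alpha> - \<beta>)\<close>
  with \<open>\<beta>\<close> a lattice point of height 1 and \<open>\<alpha> - \<beta>\<close> again in the cone. By Caratheodory, \<open>\<alpha>\<close> has nonnegative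
  coordinates \<open>r\<close> with respect to at most \<open>d + 1\<close> vertices, and \<open>\<beta>\<close> must have coordinates
  \<open>0 \<le> s \<le> r\<close> with sum 1. Divided differences take integer values on integer polynomials, so adding
  integer multiples of them to a coordinate vector preserves integrality; the divided difference over
  \<open>S\<close> has the coefficient \<open>1 / \<Prod>(y - l)\<close> at the node \<open>y\<close>. Hence the coordinates at all nodes other than a fixed
  node \<open>x\<^sub>0\<close> can be rounded one after the other, each with an error of at most \<open>1 / D\<close> where \<open>D\<close> bounds the
  gaps from below. The node \<open>x\<^sub>0\<close> with the largest coordinate, which is at least \<open>2 / (d + 1)\<close>,
  absorbs the total error \<open>d / D\<close> provided that \<open>2 D \<ge> d (d + 1)\<close>.
\<close>

section \<open>Divided differences of monomials\<close>

text \<open>The divided difference of the monomial \<open>t ^ e\<close> at the nodes in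
  \<open>S\<close>, in Lagrange form; it is independent of any order of the nodes, and 0 for empty
  \<open>S\<close>.\<close>

definition divided_difference :: "int set \<Rightarrow> nat \<Rightarrow> real" where
  "divided_difference S e = (\<Sum>x\<in>S. real_of_int x ^ e / (\<Prod>y\<in>S - {x}. real_of_int (x - y)))"

text \<open>Leibniz rule for the product of \<open>t\<close> and \<open>t ^ e\<close>: the factor
  \<open>x - z\<close> kills the term at \<open>z\<close> and cancels the factor of \<open>z\<close>
  in all other denominators.\<close>

lemma divided_difference_Suc:
  assumes "finite S" "z \<in> S"
  shows "divided_difference S (Suc e) =
    divided_difference (S - {z}) e + real_of_int z * divided_difference S e"
proof -
  let ?P = "\<lambda>S x. \<Prod>y\<in>S - {x}. real_of_int (x - y)"
  have "divided_difference S (Suc e) - real_of_int z * divided_difference S e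
     = (\<Sum>x\<in>S. real_of_int (x - z) * real_of_int x ^ e / ?P S x)"
    unfolding divided_difference_def sum_distrib_left sum_subtractf [symmetric]
    by (intro sum.cong refl) (simp add: field_simps diff_divide_distrib)
  also have "\<dots> = (\<Sum>x\<in>S - {z}. real_of_int (x - z) * real_of_int x ^ e / ?P S x)"
    using assms by (simp add: sum.remove)
  also have "\<dots> = divided_difference (S - {z}) e"
    unfolding divided_difference_def
  proof (intro sum.cong refl)
    fix x assume x: "x \<in> S - {z}"
    have "?P S x = real_of_int (x - z) * (\<Prod>y\<in>S - {x} - {z}. real_of_int (x - y))"
      using assms x by (intro prod.remove) auto
    moreover have "S - {x} - {z} = S - {z} - {x}" by auto
    ultimately show "real_of_int (x - z) * real_of_int x ^ e / ?P S x =
        real_of_int x ^ e / ?P (S - {z}) x"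
      using x by simp
  qed
  finally show ?thesis by simp
qed

text \<open>By induction, removing either of two nodes leaves equal divided differences. The
  recursion at both then gives \<open>z\<close> and \<open>z'\<close> times the same value the same
  result, so that value is 0.\<close>

lemma divided_difference_0:
  assumes "finite S" "S \<noteq> {}"
  shows "divided_difference S 0 = (if card S = 1 then 1 else 0)"
  using assms
proof (induction "card S" arbitrary: S rule: less_induct)
  case less
  show ?case
  proof (cases "card S = 1")
    case True
    then obtain x where "S = {x}" by (auto simp: card_1_singleton_iff)
    then show ?thesis by (simp add: divided_difference_def)
  next
    case False
    obtain z where z: "z \<in> S" using less.prems by auto
    have "card (S - {z}) \<noteq> 0"
      using False z less.prems by (metis Suc_diff_1 card_Diff_singleton card_gt_0_iff One_nat_def)
    then have "S - {z} \<noteq> {}" by force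
    then obtain z' where z': "z' \<in> S" "z' \<noteq> z" by auto
    have rem: "divided_difference (S - {v}) 0 = (if card S = 2 then 1 else 0)" if v: "v \<in> S" for v
    proof -
      have "card (S - {v}) < card S" using v less.prems by (intro psubset_card_mono) auto
      moreover have "S - {v} \<noteq> {}" using z z' by auto
      ultimately show ?thesis using less.hyps [of "S - {v}"] v less.prems by auto
    qed
    have "real_of_int z * divided_difference S 0 = real_of_int z' * divided_difference S 0"
      using divided_difference_Suc [OF less.prems(1) z, of 0] divided_difference_Suc [OF less.prems(1) z'(1), of 0]
        rem [OF z] rem [OF z'(1)] by linarith
    then show ?thesis using z' False by simp
  qed
qed

lemma divided_difference_Ints:
  assumes "finite S" "S \<noteq> {}"
  shows "divided_difference S e \<in> \<int>"
  using assms
proof (induction e arbitrary: S)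
  case 0
  then show ?case by (simp add: divided_difference_0)
next
  case (Suc e)
  obtain z where "z \<in> S" using Suc.prems by auto
  have "divided_difference (S - {z}) e \<in> \<int>"
  proof (cases "S - {z} = {}")
    case True
    show ?thesis unfolding divided_difference_def True by simp
  next
    case False
    then show ?thesis using Suc by simp
  qed
  then show ?case
    using Suc \<open>z \<in> S\<close> by (simp add: divided_difference_Suc)
qed

section \<open>Rounding to lattice points\<close>

text \<open>The multiples of \<open>1 / p\<close> form a grid of mesh at most \<open>1 / D\<close>;
  the floor picks the largest one up to \<open>t\<close>, and \<open>sgn p\<close> corrects the
  sign.\<close>

lemma exists_int_divide_near:
  fixes t :: real and p :: int
  assumes "D > 0" "real_of_int \<bar>p\<bar> \<ge> D"
  shows "\<exists>a::int. t - 1 / D \<le> of_int a / of_int p \<and> of_int a / of_int p \<le> t"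
proof (intro exI)
  have p: "real_of_int \<bar>p\<bar> > 0" using assms by linarith
  have eq: "of_int (sgn p * \<lfloor>t * \<bar>p\<bar>\<rfloor>) / of_int p = real_of_int \<lfloor>t * \<bar>p\<bar>\<rfloor> / real_of_int \<bar>p\<bar>"
    using p by (cases "p > 0") (auto simp: sgn_if)
  have "t * real_of_int \<bar>p\<bar> - 1 \<le> real_of_int \<lfloor>t * \<bar>p\<bar>\<rfloor>" by linarith
  then have "t - 1 / real_of_int \<bar>p\<bar> \<le> real_of_int \<lfloor>t * \<bar>p\<bar>\<rfloor> / real_of_int \<bar>p\<bar>"
    using p by (simp add: pos_le_divide_eq left_diff_distrib)
  moreover have "1 / real_of_int \<bar>p\<bar> \<le> 1 / D"
    using assms by (intro divide_left_mono mult_pos_pos p) auto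
  moreover have "real_of_int \<lfloor>t * \<bar>p\<bar>\<rfloor> / real_of_int \<bar>p\<bar> \<le> t"
    using p by (simp add: pos_divide_le_eq)
  ultimately show "t - 1 / D \<le> of_int (sgn p * \<lfloor>t * \<bar>p\<bar>\<rfloor>) / of_int p \<and>
      of_int (sgn p * \<lfloor>t * \<bar>p\<bar>\<rfloor>) / of_int p \<le> t"
    unfolding eq by linarith
qed

text \<open>Induction over the nodes to be rounded: an integer multiple of the divided difference
  weights places the coordinate at \<open>y\<close>, and the change it causes on \<open>J\<close> is
  subtracted from the targets there in advance. The coordinate at \<open>x0\<close> stays free and
  balances the sum.\<close>

lemma exists_integral_rounding:
  fixes t :: "int \<Rightarrow> real"
  assumes "finite J" "D > 0" "x0 \<notin> J" "\<And>y. y \<in> J \<Longrightarrow> real_of_int \<bar>y - x0\<bar> \<ge> D"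
  shows "\<exists>s. (\<forall>x\<in>J. t x - 1 / D \<le> s x \<and> s x \<le> t x) \<and> (\<Sum>x\<in>insert x0 J. s x) = 1 \<and>
    (\<forall>e. (\<Sum>x\<in>insert x0 J. s x * real_of_int x ^ e) \<in> \<int>)"
  using assms(1,3,4)
proof (induction J arbitrary: t rule: finite_induct)
  case empty
  show ?case by (intro exI [of _ "\<lambda>_. 1"]) simp
next
  case (insert y J)
  let ?S = "insert y (insert x0 J)"
  define w where "w x = 1 / (\<Prod>l\<in>?S - {x}. real_of_int (x - l))" for x
  define p where "p = (\<Prod>l\<in>insert x0 J. y - l)"
  have y: "y \<notin> insert x0 J" using insert.prems insert.hyps by auto
  then have wy: "w y = 1 / real_of_int p" by (simp add: w_def p_def insert_Diff_if)
  have "\<bar>p\<bar> = \<bar>y - x0\<bar> * (\<Prod>l\<in>J. \<bar>y - l\<bar>)"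
    using insert.hyps insert.prems by (simp add: p_def abs_mult abs_prod)
  \<comment> \<open>Distinct integers differ by at least 1, so the distance to \<open>x0\<close>
    alone bounds the product from below.\<close>
  moreover have "(\<Prod>l\<in>J. \<bar>y - l\<bar>) \<ge> 1"
  proof (rule prod_ge_1)
    fix l assume "l \<in> J"
    then have "l \<noteq> y" using y by auto
    then show "1 \<le> \<bar>y - l\<bar>" by linarith
  qed
  ultimately have "\<bar>p\<bar> \<ge> \<bar>y - x0\<bar>"
    by (metis abs_ge_zero mult.right_neutral mult_left_mono)
  then have "real_of_int \<bar>p\<bar> \<ge> real_of_int \<bar>y - x0\<bar>" by (simp only: of_int_le_iff)
  with insert.prems(2) [of y] have "real_of_int \<bar>p\<bar> \<ge> D" by simp
  then obtain a :: int where a: "t y - 1 / D \<le> of_int a * w y" "of_int a * w y \<le> t y"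
    using exists_int_divide_near [OF \<open>D > 0\<close>, of p "t y"] by (auto simp: wy)
  obtain s' where s': "\<And>x. x \<in> J \<Longrightarrow> t x - of_int a * w x - 1 / D \<le> s' x \<and> s' x \<le> t x - of_int a * w x"
    "(\<Sum>x\<in>insert x0 J. s' x) = 1" "\<And>e. (\<Sum>x\<in>insert x0 J. s' x * real_of_int x ^ e) \<in> \<int>"
    using insert.IH [of "\<lambda>x. t x - of_int a * w x"] insert.prems by auto
  \<comment> \<open>The induction hypothesis says nothing about \<open>s'\<close> at
    \<open>y\<close>, so \<open>s'\<close> is replaced by 0 there.\<close>
  define s where "s x = (if x = y then 0 else s' x) + of_int a * w x" for x
  have dd: "(\<Sum>x\<in>?S. w x * real_of_int x ^ e) = divided_difference ?S e" for e
    unfolding divided_difference_def by (intro sum.cong refl) (simp add: w_def)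
  have sum_s: "(\<Sum>x\<in>?S. s x * real_of_int x ^ e) =
      (\<Sum>x\<in>insert x0 J. s' x * real_of_int x ^ e) + of_int a * divided_difference ?S e" for e
  proof -
    have "(\<Sum>x\<in>?S. s x * real_of_int x ^ e) =
        (\<Sum>x\<in>?S. (if x = y then 0 else s' x) * real_of_int x ^ e) + of_int a * (\<Sum>x\<in>?S. w x * real_of_int x ^ e)"
      unfolding s_def sum_distrib_left sum.distrib [symmetric]
      by (intro sum.cong refl) (simp add: algebra_simps)
    also have "(\<Sum>x\<in>?S. (if x = y then 0 else s' x) * real_of_int x ^ e) =
        (\<Sum>x\<in>insert x0 J. (if x = y then 0 else s' x) * real_of_int x ^ e)"
      using y insert.hyps by (subst sum.insert) auto
    also have "\<dots> = (\<Sum>x\<in>insert x0 J. s' x * real_of_int x ^ e)"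
      using y by (intro sum.cong refl) auto
    finally show ?thesis by (simp add: dd)
  qed
  have card: "card ?S \<noteq> 1" using y insert.hyps by simp
  show ?case
  proof (intro exI [of _ s] conjI ballI allI)
    fix x assume x: "x \<in> insert y J"
    show "t x - 1 / D \<le> s x" "s x \<le> t x"
      using a s'(1) [of x] x insert.hyps unfolding s_def by fastforce+
  next
    \<comment> \<open>Exponent 0: over at least two nodes the weights sum to 0, so the sum remains
      1.\<close>
    show "(\<Sum>x\<in>insert x0 (insert y J). s x) = 1"
      using sum_s [of 0] s'(2) card insert.hyps
      by (simp add: divided_difference_0 insert_commute)
  next
    fix e
    show "(\<Sum>x\<in>insert x0 (insert y J). s x * real_of_int x ^ e) \<in> \<int>"
      using sum_s [of e] s'(3) [of e] insert.hyps
      by (simp add: divided_difference_Ints insert_commute)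
  qed
qed

text \<open>Coordinates below \<open>1 / D\<close> are replaced by 0, the others are rounded, and
  \<open>x0\<close> takes what is missing from 1. The condition on \<open>D\<close> says
  \<open>d / D \<le> 2 / (d + 1)\<close>, and the right-hand side bounds the largest coordinate from
  below.\<close>

lemma exists_integral_summand:
  fixes r :: "int \<Rightarrow> real" and D :: real
  assumes fin: "finite X" and card: "card X \<le> d + 1" and d: "0 < d"
    and D: "2 * D \<ge> real (d * (d + 1))"
    and dist: "\<And>x y. \<lbrakk>x \<in> X; y \<in> X; x \<noteq> y\<rbrakk> \<Longrightarrow> real_of_int \<bar>x - y\<bar> \<ge> D"
    and r: "\<And>x. x \<in> X \<Longrightarrow> 0 \<le> r x" and sum: "sum r X \<ge> 2"
  shows "\<exists>s. (\<forall>x\<in>X. 0 \<le> s x \<and> s x \<le> r x) \<and> sum s X = 1 \<and>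
    (\<forall>e. (\<Sum>x\<in>X. s x * real_of_int x ^ e) \<in> \<int>)"
proof -
  have "2 * real d \<le> (real d + 1) * real d" using d by (intro mult_right_mono) auto
  with D have dD: "real d \<le> D" by (simp add: algebra_simps)
  with d have D0: "D > 0" by linarith
  have ne: "X \<noteq> {}" using sum by auto
  obtain x0 where x0: "x0 \<in> X" "\<And>x. x \<in> X \<Longrightarrow> r x \<le> r x0"
    using Max_in [of "r ` X"] Max_ge [of "r ` X"] fin ne by fastforce
  have "2 \<le> real (card X) * r x0"
    using sum sum_bounded_above [of X r "r x0"] x0 by simp
  also have "\<dots> \<le> real (d + 1) * r x0"
    using card r [OF x0(1)] by (intro mult_right_mono) auto
  finally have r0: "2 / real (d + 1) \<le> r x0" by (simp add: field_simps)
  have "real d / D \<le> 2 / real (d + 1)" using D D0 d by (simp add: field_simps)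
  with r0 have r0': "real d / D \<le> r x0" by simp
  define J where "J = {x \<in> X - {x0}. r x \<ge> 1 / D}"
  define K where "K = {x \<in> X - {x0}. \<not> r x \<ge> 1 / D}"
  define m where "m = real (card J) / D"
  define R where "R = sum r J"
  have fJ: "finite J" "finite K" using fin by (auto simp: J_def K_def)
  have X: "X = insert x0 J \<union> K" "insert x0 J \<inter> K = {}" "x0 \<notin> J"
    using x0 by (auto simp: J_def K_def)
  have "card X = Suc (card J + card K)"
    using X fJ by (simp add: card_Un_disjoint)
  then have cards: "real (card J) + real (card K) \<le> real d" using card by linarith
  have mR: "m \<le> R"
    unfolding m_def R_def using sum_bounded_below [of J "1 / D" r] by (simp add: J_def)
  have md: "m + real (card K) / D \<le> real d / D"
    using cards D0 unfolding m_def by (simp add: add_divide_distrib [symmetric] divide_right_mono)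
  have dD1: "real d / D \<le> 1" using dD D0 by simp
  have K0: "real (card K) / D \<ge> 0" using D0 by simp
  have "sum r K \<le> real (card K) / D"
    using sum_bounded_above [of K r "1 / D"] by (force simp: K_def)
  moreover have "sum r X = r x0 + R + sum r K"
    unfolding R_def using X fJ by (simp add: sum.union_disjoint)
  \<comment> \<open>Of the total of at least 2, the nodes in \<open>K\<close> hold at most
    \<open>card K / D\<close>, which is at most \<open>1 - m\<close>.\<close>
  ultimately have R: "r x0 + R \<ge> 1 + m" using sum md dD1 by linarith
  \<comment> \<open>The targets \<open>t\<close> are \<open>r\<close> shrunk towards \<open>1 / D\<close> so that their sum is at most 1; rounding them down
    by at most \<open>1 / D\<close> keeps them nonnegative. The nodes of \<open>K\<close> get the coordinate 0.\<close>
  define \<theta> where "\<theta> = (if R \<le> 1 then 1 else (1 - m) / (R - m))"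
  have m1: "m \<le> 1" using md dD1 K0 by linarith
  have \<theta>: "0 \<le> \<theta>" "\<theta> \<le> 1" using m1 by (auto simp: \<theta>_def)
  define t where "t x = 1 / D + \<theta> * (r x - 1 / D)" for x
  have t: "1 / D \<le> t x" "t x \<le> r x" if "x \<in> J" for x
  proof -
    have "r x - 1 / D \<ge> 0" using that by (simp add: J_def)
    then show "1 / D \<le> t x" "t x \<le> r x"
      using \<theta> mult_left_le_one_le [of "r x - 1 / D" \<theta>] by (auto simp: t_def)
  qed
  \<comment> \<open>For \<open>R > 1\<close>, \<open>\<theta>\<close> solves
    \<open>m + \<theta> * (R - m) = 1\<close>; the divisor is positive since
    \<open>m \<le> 1\<close>.\<close>
  have "sum t J = m + \<theta> * (R - m)"
    unfolding t_def m_def R_def by (simp add: sum.distrib sum_distrib_left [symmetric] sum_subtractf)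
  then have sumt: "sum t J = min R 1" using m1 by (simp add: \<theta>_def)
  obtain s where s: "\<And>x. x \<in> J \<Longrightarrow> t x - 1 / D \<le> s x \<and> s x \<le> t x"
    "(\<Sum>x\<in>insert x0 J. s x) = 1" "\<And>e. (\<Sum>x\<in>insert x0 J. s x * real_of_int x ^ e) \<in> \<int>"
    using exists_integral_rounding [OF fJ(1) D0 X(3), of t] dist x0 unfolding J_def by auto
  have s_le: "sum s J \<le> min R 1" unfolding sumt [symmetric] using s by (intro sum_mono) auto
  have "sum t J - m = (\<Sum>x\<in>J. t x - 1 / D)" by (simp add: sum_subtractf m_def)
  also have "\<dots> \<le> sum s J" using s by (intro sum_mono) auto
  finally have s_ge: "min R 1 - m \<le> sum s J" using sumt by simp
  have s0: "s x0 = 1 - sum s J" using s(2) X(3) fJ by simp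
  \<comment> \<open>The upper bound has two cases: for \<open>R \<ge> 1\<close> the coordinate is at
    most \<open>m \<le> d / D \<le> r x0\<close>, otherwise at most
    \<open>1 - R + m \<le> r x0\<close>.\<close>
  have s0': "0 \<le> s x0" "s x0 \<le> r x0"
    using s0 s_le s_ge R r0' md K0 by (auto simp: min_def split: if_splits)
  define s' where "s' x = (if x \<in> insert x0 J then s x else 0)" for x
  have sum_s': "(\<Sum>x\<in>X. s' x * f x) = (\<Sum>x\<in>insert x0 J. s x * f x)" for f :: "int \<Rightarrow> real"
    using fin X by (intro sum.mono_neutral_cong_right) (auto simp: s'_def)
  show ?thesis
  proof (intro exI [of _ s'] conjI ballI allI)
    fix x assume x: "x \<in> X"
    show "0 \<le> s' x" "s' x \<le> r x"
      using s(1) [of x] t [of x] s0' r [OF x] by (auto simp: s'_def)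
  next
    show "sum s' X = 1" using sum_s' [of "\<lambda>_. 1"] s(2) by simp
  next
    fix e
    show "(\<Sum>x\<in>X. s' x * real_of_int x ^ e) \<in> \<int>" unfolding sum_s' by (rule s(3))
  qed
qed

section \<open>Conic Caratheodory\<close>

text \<open>While there is a linear dependence, the multiple of it that first brings a coefficient
  down to 0 is subtracted, which removes one vector.\<close>

lemma conic_caratheodory:
  fixes S :: "'a::real_vector set"
  assumes "finite S" "\<And>v. v \<in> S \<Longrightarrow> 0 \<le> c v"
  shows "\<exists>T b. T \<subseteq> S \<and> independent T \<and> (\<forall>v\<in>T. 0 \<le> b v) \<and>
    (\<Sum>v\<in>T. b v *\<^sub>R v) = (\<Sum>v\<in>S. c v *\<^sub>R v)"
  using assms
proof (induction "card S" arbitrary: S c rule: less_induct)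
  case less
  show ?case
  proof (cases "independent S")
    case True
    then show ?thesis using less.prems by blast
  next
    case False
    then obtain u0 v0 where u0: "v0 \<in> S" "u0 v0 \<noteq> 0" "(\<Sum>v\<in>S. u0 v *\<^sub>R v) = 0"
      using dependent_finite [OF less.prems(1)] by auto
    \<comment> \<open>The sign is chosen so that some coefficient is positive; the least ratio
      \<open>c v / u v\<close> over \<open>U\<close> then exists.\<close>
    define u where "u v = (if u0 v0 > 0 then u0 v else - u0 v)" for v
    have u: "u v0 > 0" "(\<Sum>v\<in>S. u v *\<^sub>R v) = 0"
      using u0 by (cases "u0 v0 > 0"; simp add: u_def sum_negf)+
    define U where "U = {v \<in> S. u v > 0}"
    have "finite U" "U \<noteq> {}" using less.prems u u0 by (auto simp: U_def)
    then obtain w where w: "w \<in> U" "\<And>v. v \<in> U \<Longrightarrow> c w / u w \<le> c v / u v"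
      using ex_is_arg_min_if_finite [of U "\<lambda>v. c v / u v"] by (auto simp: is_arg_min_linorder)
    define l where "l = c w / u w"
    have wS: "w \<in> S" "u w > 0" using w by (auto simp: U_def)
    have l: "l \<ge> 0" using wS less.prems(2) by (simp add: l_def)
    define c' where "c' v = c v - l * u v" for v
    have c': "0 \<le> c' v" if "v \<in> S" for v
    proof (cases "u v > 0")
      case True
      then have "l \<le> c v / u v" using w that by (auto simp: U_def l_def)
      then show ?thesis using True by (simp add: c'_def pos_le_divide_eq)
    next
      case False
      then have "l * u v \<le> 0" using l by (simp add: mult_nonneg_nonpos)
      then show ?thesis using less.prems(2) [OF that] by (simp add: c'_def)
    qed
    have "c' w = 0" using wS by (simp add: c'_def l_def)
    have "(\<Sum>v\<in>S - {w}. c' v *\<^sub>R v) = (\<Sum>v\<in>S. c' v *\<^sub>R v)"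
      using \<open>c' w = 0\<close> wS less.prems by (simp add: sum.remove)
    also have "\<dots> = (\<Sum>v\<in>S. c v *\<^sub>R v) - l *\<^sub>R (\<Sum>v\<in>S. u v *\<^sub>R v)"
      by (simp add: c'_def scaleR_left_diff_distrib sum_subtractf scaleR_sum_right)
    finally have eq: "(\<Sum>v\<in>S - {w}. c' v *\<^sub>R v) = (\<Sum>v\<in>S. c v *\<^sub>R v)" by (simp add: u)
    have "card (S - {w}) < card S" using wS less.prems by (intro psubset_card_mono) auto
    from less.hyps [OF this, of c'] c' less.prems(1)
    obtain T b where "T \<subseteq> S - {w}" "independent T" "\<forall>v\<in>T. 0 \<le> b v"
      "(\<Sum>v\<in>T. b v *\<^sub>R v) = (\<Sum>v\<in>S - {w}. c' v *\<^sub>R v)"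
      by auto
    then show ?thesis using eq by (intro exI [of _ T] exI [of _ b]) auto
  qed
qed

section \<open>Combinations\<close>

lemma combinations_mono:
  assumes "K \<subseteq> L"
  shows "combinations K A \<subseteq> combinations L A"
  unfolding combinations_def using assms by blast

lemma zero_in_combinations: "0 \<in> combinations K A"
  unfolding combinations_def by (auto intro!: exI [of _ "{}"])

lemma add_in_combinations_Nats:
  assumes "a \<in> A" "x \<in> combinations \<nat> A"
  shows "a + x \<in> combinations \<nat> A"
proof -
  obtain F c where F: "finite F" "F \<subseteq> A" "\<And>y. y \<in> F \<Longrightarrow> c y \<in> \<nat>" "x = (\<Sum>y\<in>F. c y *\<^sub>R y)"
    using assms(2) unfolding combinations_def by auto
  \<comment> \<open>The vector \<open>a\<close> may or may not lie in \<open>F\<close>; extending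
    \<open>c\<close> by 0 treats both cases at once.\<close>
  define c' where "c' y = (if y = a then 1 else 0) + (if y \<in> F then c y else 0)" for y
  have "(\<Sum>y\<in>insert a F. c' y *\<^sub>R y) =
      (\<Sum>y\<in>insert a F. if y = a then y else 0) + (\<Sum>y\<in>insert a F. if y \<in> F then c y *\<^sub>R y else 0)"
    unfolding sum.distrib [symmetric] by (intro sum.cong refl) (simp add: c'_def scaleR_left_distrib)
  also have "(\<Sum>y\<in>insert a F. if y \<in> F then c y *\<^sub>R y else 0) = x"
    unfolding F(4) using F(1) by (intro sum.mono_neutral_cong_right) auto
  finally have "a + x = (\<Sum>y\<in>insert a F. c' y *\<^sub>R y)" using F(1) by (simp add: sum.delta)
  moreover have "c' y \<in> \<nat>" for y using F(3) by (simp add: c'_def)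
  ultimately show ?thesis
    unfolding combinations_def using F(1,2) assms(1)
    by (intro CollectI exI [of _ "insert a F"] exI [of _ c']) auto
qed

lemma sum_fun_apply: "(\<Sum>i\<in>I. f i) k = (\<Sum>i\<in>I. (f i k :: 'b::comm_monoid_add))"
  by (induction I rule: infinite_finite_induct) auto

lemma combinations_Ints_subset_integer_points:
  assumes "A \<subseteq> integer_points"
  shows "combinations \<int> A \<subseteq> integer_points"
proof
  fix x assume "x \<in> combinations \<int> A"
  then obtain F c where F: "F \<subseteq> A" "\<And>y. y \<in> F \<Longrightarrow> c y \<in> \<int>" "x = (\<Sum>y\<in>F. c y *\<^sub>R y)"
    unfolding combinations_def by auto
  then show "x \<in> integer_points"
    using assms unfolding integer_points_def
    by (auto simp: sum_fun_apply scaleR_fun_def intro!: Ints_sum Ints_mult)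
qed

section \<open>The cone over a cyclic polytope\<close>

text \<open>These vectors generate the cone. Homogenizing shifts indices so that coordinate
  \<open>k\<close> is the power \<open>x ^ k\<close> for \<open>k \<le> d\<close>; coordinate 0 of a
  combination is the sum of its coefficients.\<close>

definition moment_vector :: "nat \<Rightarrow> int \<Rightarrow> nat \<Rightarrow> real" where
  "moment_vector d x = homogenize (moment_point d (real_of_int x))"

lemma moment_vector_apply: "moment_vector d x k = (if k \<le> d then real_of_int x ^ k else 0)"
  by (cases k) (auto simp: moment_vector_def homogenize_def moment_point_def)

lemma inj_moment_vector:
  assumes "0 < d"
  shows "inj (moment_vector d)"
proof (rule injI)
  fix x y assume "moment_vector d x = moment_vector d y"
  then have "moment_vector d x 1 = moment_vector d y 1" by simp
  then show "x = y" using assms by (simp add: moment_vector_apply)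
qed

lemma sum_moment_vector_apply:
  "(\<Sum>x\<in>X. r x *\<^sub>R moment_vector d x) k = (if k \<le> d then \<Sum>x\<in>X. r x * real_of_int x ^ k else 0)"
  by (simp add: sum_fun_apply scaleR_fun_def moment_vector_apply)

text \<open>The ambient function space is infinite-dimensional; the bound comes from the span of the
  \<open>d + 1\<close> unit vectors that contains all moment vectors.\<close>

lemma card_independent_moment_vectors:
  assumes "independent (moment_vector d ` X)" "0 < d"
  shows "finite X \<and> card X \<le> d + 1"
proof -
  define e :: "nat \<Rightarrow> nat \<Rightarrow> real" where "e j = (\<lambda>k. if k = j then 1 else 0)" for j
  have "moment_vector d x = (\<Sum>j\<le>d. real_of_int x ^ j *\<^sub>R e j)" for x
    by (rule ext) (simp add: sum_fun_apply scaleR_fun_def moment_vector_apply e_def if_distrib cong: if_cong)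
  then have "moment_vector d ` X \<subseteq> span (e ` {..d})"
    by (auto intro!: span_sum span_scale intro: span_base)
  then have "finite (moment_vector d ` X) \<and> card (moment_vector d ` X) \<le> card (e ` {..d})"
    by (intro independent_span_bound assms) auto
  moreover have "card (e ` {..d}) \<le> d + 1" using card_image_le [of "{..d}" e] by simp
  moreover have "inj_on (moment_vector d) X"
    using inj_moment_vector [OF assms(2)] by (rule inj_on_subset) auto
  ultimately show ?thesis by (simp add: card_image finite_image_iff)
qed

lemma sum_moment_vector_caratheodory:
  assumes "finite X" "0 < d" "\<And>x. x \<in> X \<Longrightarrow> 0 \<le> c x"
  shows "\<exists>Y b. Y \<subseteq> X \<and> card Y \<le> d + 1 \<and> (\<forall>x\<in>Y. 0 \<le> b x) \<and>
    (\<Sum>x\<in>Y. b x *\<^sub>R moment_vector d x) = (\<Sum>x\<in>X. c x *\<^sub>R moment_vector d x)"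
proof -
  let ?v = "moment_vector d"
  have inj: "inj ?v" by (rule inj_moment_vector [OF assms(2)])
  have inj': "inj_on ?v Y" for Y using inj by (rule inj_on_subset) auto
  have c: "0 \<le> c (inv ?v v)" if "v \<in> ?v ` X" for v
    using that by (elim imageE) (simp add: inv_f_f [OF inj] assms(3))
  obtain T b where T: "T \<subseteq> ?v ` X" "independent T" "\<forall>v\<in>T. 0 \<le> b v"
    "(\<Sum>v\<in>T. b v *\<^sub>R v) = (\<Sum>v\<in>?v ` X. c (inv ?v v) *\<^sub>R v)"
    by atomize_elim (rule conic_caratheodory [OF finite_imageI [OF assms(1)]], rule c)
  obtain Y where Y: "Y \<subseteq> X" "T = ?v ` Y" using T(1) by (auto simp: subset_image_iff)
  show ?thesis
    using T Y card_independent_moment_vectors [of d Y] assms(2)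
    by (intro exI [of _ Y] exI [of _ "b \<circ> ?v"]) (simp add: sum.reindex [OF inj'] inj)
qed

lemma homogenize_affine:
  assumes "u + v = 1"
  shows "homogenize (u *\<^sub>R a + v *\<^sub>R b) = u *\<^sub>R homogenize a + v *\<^sub>R homogenize b"
  using assms by (intro ext) (simp add: homogenize_def scaleR_fun_def split: nat.split)

text \<open>Homogenization is affine, so preimages of convex sets are convex and the nontrivial
  inclusion need only be checked on \<open>V\<close>.\<close>

lemma convex_hull_homogenize:
  "convex hull (homogenize ` (convex hull V)) = convex hull (homogenize ` V)"
proof (rule antisym)
  have "convex {a. homogenize a \<in> convex hull (homogenize ` V)}"
    by (rule convexI) (simp add: homogenize_affine convexD [OF convex_convex_hull])
  then have "convex hull V \<subseteq> {a. homogenize a \<in> convex hull (homogenize ` V)}"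
    by (intro hull_minimal) (auto intro: hull_inc)
  then show "convex hull (homogenize ` (convex hull V)) \<subseteq> convex hull (homogenize ` V)"
    by (intro hull_minimal) auto
  show "convex hull (homogenize ` V) \<subseteq> convex hull (homogenize ` (convex hull V))"
    by (intro hull_mono image_mono hull_subset)
qed

text \<open>Gives lattice points of height 1 coordinates indexed by the integer nodes, the form in
  which they are split and rounded.\<close>

lemma lattice_config_cyclic_polytope:
  fixes \<tau> :: "nat \<Rightarrow> int"
  assumes "0 < d"
  shows "lattice_config (cyclic_polytope d n (\<lambda>i. real_of_int (\<tau> i))) =
    {\<Sum>x\<in>\<tau> ` {1..n}. c x *\<^sub>R moment_vector d x | c. (\<forall>x\<in>\<tau> ` {1..n}. 0 \<le> c x) \<and> sum c (\<tau> ` {1..n}) = 1}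
      \<inter> integer_points"
proof -
  let ?X = "\<tau> ` {1..n}" and ?v = "moment_vector d"
  have inj: "inj ?v" by (rule inj_moment_vector [OF assms])
  have inj': "inj_on ?v Y" for Y using inj by (rule inj_on_subset) auto
  have "homogenize ` (\<lambda>i. moment_point d (real_of_int (\<tau> i))) ` {1..n} = ?v ` ?X"
    by (auto simp: moment_vector_def image_image)
  then have "convex hull (homogenize ` cyclic_polytope d n (\<lambda>i. real_of_int (\<tau> i))) = convex hull (?v ` ?X)"
    by (simp add: cyclic_polytope_def convex_hull_homogenize)
  also have "\<dots> = {\<Sum>x\<in>?X. c x *\<^sub>R ?v x | c. (\<forall>x\<in>?X. 0 \<le> c x) \<and> sum c ?X = 1}"
  proof (intro equalityI subsetI)
    fix y assume "y \<in> convex hull (?v ` ?X)"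
    then obtain u where "\<forall>v\<in>?v ` ?X. 0 \<le> u v" "sum u (?v ` ?X) = 1" "(\<Sum>v\<in>?v ` ?X. u v *\<^sub>R v) = y"
      by (auto simp: convex_hull_finite)
    then show "y \<in> {\<Sum>x\<in>?X. c x *\<^sub>R ?v x | c. (\<forall>x\<in>?X. 0 \<le> c x) \<and> sum c ?X = 1}"
      by (intro CollectI exI [of _ "u \<circ> ?v"]) (simp add: sum.reindex [OF inj'])
  next
    fix y assume "y \<in> {\<Sum>x\<in>?X. c x *\<^sub>R ?v x | c. (\<forall>x\<in>?X. 0 \<le> c x) \<and> sum c ?X = 1}"
    then obtain c where "\<forall>x\<in>?X. 0 \<le> c x" "sum c ?X = 1" "y = (\<Sum>x\<in>?X. c x *\<^sub>R ?v x)" by auto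
    then show "y \<in> convex hull (?v ` ?X)"
      by (auto intro!: convex_sum [OF _ convex_convex_hull] intro: hull_inc)
  qed
  finally show ?thesis by (simp add: lattice_config_def)
qed

text \<open>Induction on the height, which is the sum of the coordinates: each step splits off one
  lattice point of height 1.\<close>

lemma normal_cyclic_polytope:
  fixes \<tau> :: "nat \<Rightarrow> int" and D :: real
  assumes d: "0 < d" and D: "2 * D \<ge> real (d * (d + 1))"
    and dist: "\<And>x y. \<lbrakk>x \<in> \<tau> ` {1..n}; y \<in> \<tau> ` {1..n}; x \<noteq> y\<rbrakk> \<Longrightarrow> real_of_int \<bar>x - y\<bar> \<ge> D"
  shows "normal_polytope (cyclic_polytope d n (\<lambda>i. real_of_int (\<tau> i)))"
proof -
  let ?X = "\<tau> ` {1..n}" and ?v = "moment_vector d"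
  define A where "A = lattice_config (cyclic_polytope d n (\<lambda>i. real_of_int (\<tau> i)))"
  note A = lattice_config_cyclic_polytope [OF d, of n \<tau>, folded A_def]
  have split: "(\<Sum>x\<in>?X. c x *\<^sub>R ?v x) \<in> combinations \<nat> A"
    if "(\<Sum>x\<in>?X. c x *\<^sub>R ?v x) \<in> integer_points" "\<And>x. x \<in> ?X \<Longrightarrow> 0 \<le> c x" "sum c ?X = real k" for c k
    using that
  proof (induction k arbitrary: c rule: less_induct)
    case (less k)
    let ?a = "\<Sum>x\<in>?X. c x *\<^sub>R ?v x"
    consider "k = 0" | "k = 1" | "k \<ge> 2" by linarith
    then show ?case
    proof cases
      case 1
      then have "\<forall>x\<in>?X. c x = 0" using less.prems(2,3) sum_nonneg_eq_0_iff [of ?X c] by simp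
      then have "?a = 0" by (intro sum.neutral) simp
      then show ?thesis by (simp only: zero_in_combinations)
    next
      case 2
      then have "?a \<in> A" unfolding A using less.prems by auto
      then show ?thesis using add_in_combinations_Nats [OF _ zero_in_combinations] by fastforce
    next
      case 3
      obtain Y b where Y: "Y \<subseteq> ?X" "card Y \<le> d + 1" "\<forall>x\<in>Y. 0 \<le> b x"
        "(\<Sum>x\<in>Y. b x *\<^sub>R ?v x) = ?a"
        by atomize_elim (rule sum_moment_vector_caratheodory, simp, rule d, rule less.prems(2))
      have fY: "finite Y" using Y(1) by (rule finite_subset) simp
      \<comment> \<open>Comparing coordinate 0 shows that passing to at most \<open>d + 1\<close>
        nodes preserves the height.\<close>
      have "sum b Y = real k"
        using less.prems(3) Y(4) [THEN fun_cong, of 0] by (simp add: sum_moment_vector_apply)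
      then have "2 \<le> sum b Y" using 3 by simp
      then obtain s where s: "\<forall>x\<in>Y. 0 \<le> s x \<and> s x \<le> b x" "sum s Y = 1"
        "\<forall>e. (\<Sum>x\<in>Y. s x * real_of_int x ^ e) \<in> \<int>"
        by atomize_elim (rule exists_integral_summand [OF fY Y(2) d D], use dist Y in \<open>auto simp: subset_iff\<close>)
      define s' where "s' x = (if x \<in> Y then s x else 0)" for x
      define c' where "c' x = (if x \<in> Y then b x - s x else 0)" for x
      have ext: "(\<Sum>x\<in>?X. s' x *\<^sub>R f x) = (\<Sum>x\<in>Y. s x *\<^sub>R f x)"
        "(\<Sum>x\<in>?X. c' x *\<^sub>R f x) = (\<Sum>x\<in>Y. (b x - s x) *\<^sub>R f x)" for f :: "int \<Rightarrow> 'b::real_vector"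
        using Y(1) by (auto intro!: sum.mono_neutral_cong_right simp: s'_def c'_def)
      let ?b = "\<Sum>x\<in>?X. s' x *\<^sub>R ?v x"
      have b_int: "?b \<in> integer_points"
        unfolding ext integer_points_def using s(3) by (simp add: sum_moment_vector_apply)
      moreover have "sum s' ?X = 1" using ext(1) [of "\<lambda>_. 1::real"] s(2) by simp
      moreover have "\<forall>x\<in>?X. 0 \<le> s' x" using s(1) by (simp add: s'_def)
      ultimately have bA: "?b \<in> A" unfolding A by auto
      have diff: "(\<Sum>x\<in>?X. c' x *\<^sub>R ?v x) = ?a - ?b"
        unfolding ext Y(4) [symmetric] by (simp add: scaleR_left_diff_distrib sum_subtractf)
      have "sum c' ?X = real (k - 1)"
        using ext(2) [of "\<lambda>_. 1::real"] \<open>sum b Y = real k\<close> s(2) 3 by (simp add: sum_subtractf of_nat_diff)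
      moreover have "0 \<le> c' x" for x using s(1) by (simp add: c'_def)
      moreover have "(\<Sum>x\<in>?X. c' x *\<^sub>R ?v x) \<in> integer_points"
        unfolding diff using b_int less.prems(1) by (simp add: integer_points_def)
      ultimately have "?a - ?b \<in> combinations \<nat> A"
        using less.IH [of "k - 1" c'] 3 diff by simp
      from add_in_combinations_Nats [OF bA this] show ?thesis by simp
    qed
  qed
  \<comment> \<open>Being an integer combination makes \<open>x\<close> an integer vector, and lying
    in the rational cone gives it nonnegative coordinates at the nodes. Coordinate 0 makes their sum
    a natural number, so \<open>split\<close> applies.\<close>
  have "x \<in> combinations \<nat> A" if x: "x \<in> combinations \<int> A" "x \<in> combinations {q \<in> \<rat>. 0 \<le> q} A" for x
  proof -
    have int: "x \<in> integer_points"
      using combinations_Ints_subset_integer_points [of A] x(1) by (auto simp: A_def lattice_config_def)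
    obtain F q where F: "F \<subseteq> A" "\<And>a. a \<in> F \<Longrightarrow> 0 \<le> q a" "x = (\<Sum>a\<in>F. q a *\<^sub>R a)"
      using x(2) unfolding combinations_def by auto
    have "\<forall>a\<in>F. \<exists>c. (\<forall>x\<in>?X. 0 \<le> c x) \<and> a = (\<Sum>x\<in>?X. c x *\<^sub>R ?v x)"
      using F(1) unfolding A by blast
    then obtain g where g: "\<forall>a\<in>F. (\<forall>x\<in>?X. 0 \<le> g a x) \<and> a = (\<Sum>x\<in>?X. g a x *\<^sub>R ?v x)"
      by atomize_elim (rule bchoice)
    define c where "c x = (\<Sum>a\<in>F. q a * g a x)" for x
    have c: "0 \<le> c y" if "y \<in> ?X" for y
      unfolding c_def using F g that by (intro sum_nonneg mult_nonneg_nonneg) auto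
    have "x = (\<Sum>a\<in>F. q a *\<^sub>R (\<Sum>x\<in>?X. g a x *\<^sub>R ?v x))"
      unfolding F(3) by (intro sum.cong refl arg_cong [of _ _ "scaleR _"]) (use g in blast)
    also have "\<dots> = (\<Sum>x\<in>?X. c x *\<^sub>R ?v x)"
      unfolding c_def scaleR_sum_right scaleR_sum_left by (subst sum.swap) simp
    finally have xc: "x = (\<Sum>x\<in>?X. c x *\<^sub>R ?v x)" .
    have "x 0 = sum c ?X" unfolding xc by (simp add: sum_moment_vector_apply)
    moreover have "x 0 \<in> \<int>" using int by (simp add: integer_points_def)
    ultimately have "sum c ?X \<in> \<nat>" using c by (simp add: Nats_altdef2 sum_nonneg)
    then obtain k where "sum c ?X = real k" by (auto elim: Nats_cases)
    then show ?thesis using split [of c k] int c unfolding xc by blast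
  qed
  moreover have "combinations \<nat> A \<subseteq> combinations \<int> A"
    by (rule combinations_mono) (rule Nats_subset_Ints)
  moreover have "combinations \<nat> A \<subseteq> combinations {q \<in> \<rat>. 0 \<le> q} A"
    by (rule combinations_mono) (auto elim!: Nats_cases)
  ultimately show ?thesis unfolding normal_polytope_def A_def [symmetric] by blast
qed

text \<open>The step from \<open>i\<close> to \<open>i + 1\<close> already supplies the gap;
  monotonicity covers the rest.\<close>

lemma strict_mono_on_gap:
  fixes \<tau> :: "nat \<Rightarrow> int"
  assumes "strict_mono_on {1..n} \<tau>" "\<And>i. \<lbrakk>1 \<le> i; i < n\<rbrakk> \<Longrightarrow> \<tau> (i + 1) - \<tau> i \<ge> g"
    and ij: "1 \<le> i" "i < j" "j \<le> n"
  shows "\<tau> j - \<tau> i \<ge> g"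
proof -
  have "\<tau> (i + 1) \<le> \<tau> j"
    using strict_mono_on_leD [OF assms(1), of "i + 1" j] ij by simp
  then show ?thesis using assms(2) [of i] ij by linarith
qed

theorem theorem2p1:
  fixes d :: nat
  assumes "0 < d"
  shows "(\<forall>(n::nat) (\<tau> :: nat \<Rightarrow> int). d + 1 \<le> n \<longrightarrow> strict_mono_on {1..n} \<tau> \<longrightarrow>
            (\<forall>i. 1 \<le> i \<and> i \<le> n - 1 \<longrightarrow> \<tau> (i + 1) - \<tau> i \<ge> (int d)\<^sup>2 - 1) \<longrightarrow>
            normal_polytope (cyclic_polytope d n (\<lambda>i. real_of_int (\<tau> i))))
         \<and> int (gamma d) \<le> (int d)\<^sup>2 - 1"
proof -
  have normal: "normal_polytope (cyclic_polytope d n (\<lambda>i. real_of_int (\<tau> i)))"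
    if mono: "strict_mono_on {1..n} \<tau>"
      and gap: "\<And>i. \<lbrakk>1 \<le> i; i < n\<rbrakk> \<Longrightarrow> \<tau> (i + 1) - \<tau> i \<ge> (int d)\<^sup>2 - 1"
    for n and \<tau> :: "nat \<Rightarrow> int"
  proof -
    \<comment> \<open>For \<open>d = 1\<close> the gap condition is vacuous, and strict monotonicity supplies the gap 1.\<close>
    define D where "D = max 1 ((int d)\<^sup>2 - 1)"
    have "int d * (int d + 1) \<le> 2 * D"
    proof (cases "d = 1")
      case False
      \<comment> \<open>The difference \<open>2 * (d^2 - 1) - d * (d + 1)\<close> factors as
        \<open>(d - 2) * (d + 1)\<close>.\<close>
      then have "0 \<le> (int d - 2) * (int d + 1)" using assms by (intro mult_nonneg_nonneg) auto
      then show ?thesis by (simp add: D_def power2_eq_square algebra_simps)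
    qed (simp add: D_def)
    then have D: "real (d * (d + 1)) \<le> 2 * real_of_int D"
      by (metis (no_types) of_int_mult of_int_numeral of_int_le_iff of_int_of_nat_eq of_nat_1 of_nat_add of_nat_mult)
    have gap': "\<tau> (i + 1) - \<tau> i \<ge> D" if i: "1 \<le> i" "i < n" for i
      using gap [OF i] strict_mono_onD [OF mono, of i "i + 1"] i by (simp add: D_def)
    have dist: "\<bar>x - y\<bar> \<ge> D" if xy: "x \<in> \<tau> ` {1..n}" "y \<in> \<tau> ` {1..n}" "x \<noteq> y" for x y
    proof -
      obtain i j where ij: "x = \<tau> i" "y = \<tau> j" "i \<in> {1..n}" "j \<in> {1..n}" "i \<noteq> j"
        using xy by blast
      then consider "i < j" | "j < i" by linarith
      then show ?thesis
        using strict_mono_on_gap [OF mono gap', of i j] strict_mono_on_gap [OF mono gap', of j i] ij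
        by cases auto
    qed
    show ?thesis
      using normal_cyclic_polytope [OF assms D, of \<tau> n] dist by fastforce
  qed
  \<comment> \<open>\<open>gamma\<close> is a natural number; since \<open>d\<close> is positive,
    truncated subtraction agrees with the integer bound.\<close>
  have sq: "int (d\<^sup>2 - 1) = (int d)\<^sup>2 - 1" using assms by (simp add: of_nat_diff)
  have "gamma d \<le> d\<^sup>2 - 1"
    unfolding gamma_def by (rule Least_le) (use normal sq in auto)
  then have "int (gamma d) \<le> (int d)\<^sup>2 - 1" unfolding sq [symmetric] by (simp only: of_nat_le_iff)
  then show ?thesis using normal by auto
qed

end
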